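(* Let $(X,\mu,T)$ be a measure-preserving $G$-system, where $G$ is the free group of rank $r$. For any finite observable $\beta\colon X\to B$ there exist sequences $\{\mathbf y_n\in B^n\}_{n=1}^\infty$ and $\{\sigma_n\in\mathrm{Hom}(G,\mathrm{Sym}(n))\}_{n=1}^\infty$ such that $\lim_{n\to\infty}d_0^*(P^{\sigma_n}_{\mathbf y_n},\beta^G_*\mu)=0$.
   Context: $G$ is the free group of rank $r\ge1$ with free generators $s_1,\dots,s_r$ and identity $e$. $(X,\mu)$ is a standard probability space and $T$ is a homomorphism from $G$ to its group of measure-preserving automorphisms. A finite observable is a measurable map $\beta\colon X\to B$ to a finite set $B$; $\beta^G\colon X\to B^G$ is $(\beta^G(x))_g=\beta(T_gx)$. For $\sigma\in\mathrm{Hom}(G,\mathrm{Sym}(n))$ and $\mathbf y\in B^n$, define $\mathbf y^G\colon[n]\to B^G$ by $(\mathbf y^G(j))_g=\mathbf y(\sigma(g)j)$, and $P^\sigma_{\mathbf y}=(\mathbf y^G)_*\mathrm{Unif}(n)\in\mathrm{Prob}(B^G)$. For finite $H\subset G$, $d^H(\nu,\nu')$ is the total variation distance ($\frac12$ of the $\ell^1$ distance) between the marginals of $\nu,\nu'\in\mathrm{Prob}(B^G)$ on $B^H$, and $d_0^*(\nu,\nu')=\sum_{i=1}^rd^{\{e,s_i\}}(\nu,\nu')$. *)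

theory Defs
  imports "HOL-Probability.Probability" "HOL-Algebra.Bij" "HOL-Algebra.Generated_Groups"
    "HOL-Algebra.Sym_Groups"
begin

section \<open>Free groups\<close>

text \<open>The letter \<open>(i, True)\<close> stands for \<open>s i\<close> and \<open>(i, False)\<close> for its inverse.\<close>

type_synonym letter = "nat \<times> bool"

definition inverse_letter :: "letter \<Rightarrow> letter"
  where "inverse_letter a = (fst a, \<not> snd a)"

definition reduced :: "letter list \<Rightarrow> bool"
  where "reduced w \<longleftrightarrow> (\<forall>k. Suc k < length w \<longrightarrow> w ! Suc k \<noteq> inverse_letter (w ! k))"

definition letter_value :: "('g, 'c) monoid_scheme \<Rightarrow> (nat \<Rightarrow> 'g) \<Rightarrow> letter \<Rightarrow> 'g"
  where "letter_value G s a = (if snd a then s (fst a) else inv\<^bsub>G\<^esub> (s (fst a)))"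

definition word_value :: "('g, 'c) monoid_scheme \<Rightarrow> (nat \<Rightarrow> 'g) \<Rightarrow> letter list \<Rightarrow> 'g"
  where "word_value G s w = foldr (\<lambda>a g. letter_value G s a \<otimes>\<^bsub>G\<^esub> g) w \<one>\<^bsub>G\<^esub>"

text \<open>The last condition also forces \<open>s\<close> to be injective on \<open>{1..r}\<close>.\<close>

definition free_group_rank :: "('g, 'c) monoid_scheme \<Rightarrow> (nat \<Rightarrow> 'g) \<Rightarrow> nat \<Rightarrow> bool"
  where "free_group_rank G s r \<longleftrightarrow>
    group G \<and> s ` {1..r} \<subseteq> carrier G \<and> generate G (s ` {1..r}) = carrier G \<and>
    (\<forall>w. reduced w \<and> w \<noteq> [] \<and> fst ` set w \<subseteq> {1..r} \<longrightarrow> word_value G s w \<noteq> \<one>\<^bsub>G\<^esub>)"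

section \<open>Measure-preserving systems\<close>

definition standard_borel :: "'x measure \<Rightarrow> bool"
  where "standard_borel M \<longleftrightarrow>
    (\<exists>X. completely_metrizable_space X \<and> second_countable X \<and> topspace X = space M \<and>
      sets M = sigma_sets (space M) {U. openin X U})"

definition standard_prob_space :: "'x measure \<Rightarrow> bool"
  where "standard_prob_space M \<longleftrightarrow> prob_space M \<and> standard_borel M"

text \<open>Automorphisms are genuine bijections, not identified modulo null sets.\<close>

definition mp_automorphisms :: "'x measure \<Rightarrow> ('x \<Rightarrow> 'x) set"
  where "mp_automorphisms M = {f \<in> Bij (space M).
    f \<in> measurable M M \<and> inv_into (space M) f \<in> measurable M M \<and> distr M M f = M}"

definition mp_aut_group :: "'x measure \<Rightarrow> ('x \<Rightarrow> 'x) monoid"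
  where "mp_aut_group M = (BijGroup (space M)) \<lparr>carrier := mp_automorphisms M\<rparr>"

section \<open>Distributions on \<open>B\<^sup>G\<close>\<close>

definition labelings :: "('g, 'c) monoid_scheme \<Rightarrow> 'b set \<Rightarrow> ('g \<Rightarrow> 'b) measure"
  where "labelings G B = PiM (carrier G) (\<lambda>_. count_space B)"

text \<open>Used both for an action on a probability space and, with \<open>T = \<sigma>\<close> a permutation
  representation and \<open>\<beta>\<close> a labeling of \<open>{1..n}\<close>, for finite models.\<close>

definition observable_orbit ::
    "('g, 'c) monoid_scheme \<Rightarrow> ('g \<Rightarrow> 'x \<Rightarrow> 'x) \<Rightarrow> ('x \<Rightarrow> 'b) \<Rightarrow> 'x \<Rightarrow> 'g \<Rightarrow> 'b"
  where "observable_orbit G T \<beta> x = (\<lambda>g\<in>carrier G. \<beta> (T g x))"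

definition observable_distr ::
    "('g, 'c) monoid_scheme \<Rightarrow> 'b set \<Rightarrow> 'x measure \<Rightarrow> ('g \<Rightarrow> 'x \<Rightarrow> 'x) \<Rightarrow> ('x \<Rightarrow> 'b) \<Rightarrow>
      ('g \<Rightarrow> 'b) measure"
  where "observable_distr G B M T \<beta> = distr M (labelings G B) (observable_orbit G T \<beta>)"

definition empirical_distr ::
    "('g, 'c) monoid_scheme \<Rightarrow> 'b set \<Rightarrow> nat \<Rightarrow> ('g \<Rightarrow> nat \<Rightarrow> nat) \<Rightarrow> (nat \<Rightarrow> 'b) \<Rightarrow>
      ('g \<Rightarrow> 'b) measure"
  where "empirical_distr G B n \<sigma> y =
    distr (uniform_count_measure {1..n}) (labelings G B) (observable_orbit G \<sigma> y)"

definition marginal :: "'b set \<Rightarrow> 'g set \<Rightarrow> ('g \<Rightarrow> 'b) measure \<Rightarrow> ('g \<Rightarrow> 'b) measure"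
  where "marginal B H \<nu> = distr \<nu> (PiM H (\<lambda>_. count_space B)) (\<lambda>x. restrict x H)"

definition marginal_dist ::
    "'b set \<Rightarrow> 'g set \<Rightarrow> ('g \<Rightarrow> 'b) measure \<Rightarrow> ('g \<Rightarrow> 'b) measure \<Rightarrow> real"
  where "marginal_dist B H \<nu> \<nu>' = 1/2 *
    (\<Sum>z \<in> H \<rightarrow>\<^sub>E B. \<bar>measure (marginal B H \<nu>) {z} - measure (marginal B H \<nu>') {z}\<bar>)"

definition d0_star ::
    "('g, 'c) monoid_scheme \<Rightarrow> (nat \<Rightarrow> 'g) \<Rightarrow> nat \<Rightarrow> 'b set \<Rightarrow>
      ('g \<Rightarrow> 'b) measure \<Rightarrow> ('g \<Rightarrow> 'b) measure \<Rightarrow> real"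
  where "d0_star G s r B \<nu> \<nu>' = (\<Sum>i = 1..r. marginal_dist B {\<one>\<^bsub>G\<^esub>, s i} \<nu> \<nu>')"

section \<open>Automorphisms form a group and free groups exist\<close>

lemma mp_automorphisms_subgroup: "subgroup (mp_automorphisms M) (BijGroup (space M))"
proof -
  interpret group "BijGroup (space M)" by (rule group_BijGroup)
  have inv: "inv\<^bsub>BijGroup (space M)\<^esub> f = restrict (inv_into (space M) f) (space M)"
    if "f \<in> Bij (space M)" for f
    using that by (rule inv_BijGroup)
  show ?thesis
  proof (rule subgroupI)
    show "mp_automorphisms M \<subseteq> carrier (BijGroup (space M))"
      by (auto simp: mp_automorphisms_def BijGroup_def)
    have "(\<lambda>x\<in>space M. x) \<in> mp_automorphisms M"
    proof -
      have 1: "(\<lambda>x\<in>space M. x) \<in> measurable M M"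
        by (subst measurable_cong[where g = "\<lambda>x. x"]) auto
      have 2: "inv_into (space M) (\<lambda>x\<in>space M. x) \<in> measurable M M"
        by (subst measurable_cong[where g = "\<lambda>x. x"])
          (auto intro!: inv_into_f_eq simp: inj_on_def)
      have "distr M M (\<lambda>x\<in>space M. x) = distr M M (\<lambda>x. x)" by (rule distr_cong) auto
      with 1 2 show ?thesis by (simp add: mp_automorphisms_def id_Bij distr_id2)
    qed
    then show "mp_automorphisms M \<noteq> {}" by auto
  next
    fix f assume f: "f \<in> mp_automorphisms M"
    then have b: "f \<in> Bij (space M)" and bb: "bij_betw f (space M) (space M)"
      and m: "f \<in> measurable M M" and mi: "inv_into (space M) f \<in> measurable M M"
      and d: "distr M M f = M"
      by (auto simp: mp_automorphisms_def Bij_def)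
    let ?h = "restrict (inv_into (space M) f) (space M)"
    have h: "?h \<in> Bij (space M)" by (rule restrict_inv_into_Bij[OF b])
    have hm: "?h \<in> measurable M M"
      using mi by (subst measurable_cong[where g = "inv_into (space M) f"]) auto
    have hb: "bij_betw ?h (space M) (space M)" using h by (auto simp: Bij_def)
    have hf: "?h (f x) = x" if "x \<in> space M" for x
      using that bb by (auto simp: bij_betw_def inv_into_f_f)
    have "inv_into (space M) ?h x = f x" if "x \<in> space M" for x
      using hf[OF that] that hb bb
      by (metis bij_betw_def bij_betwE inv_into_f_f)
    then have him: "inv_into (space M) ?h \<in> measurable M M"
      using m by (subst measurable_cong[where g = f]) auto
    have "distr M M ?h = distr (distr M M f) M ?h" by (simp add: d)
    also have "\<dots> = distr M M (?h \<circ> f)" by (rule distr_distr[OF hm m])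
    also have "\<dots> = distr M M (\<lambda>x. x)" by (rule distr_cong) (use hf in auto)
    also have "\<dots> = M" by (rule distr_id2) simp
    finally show "inv\<^bsub>BijGroup (space M)\<^esub> f \<in> mp_automorphisms M"
      using h hm him unfolding inv[OF b] mp_automorphisms_def by blast
  next
    fix f g assume f: "f \<in> mp_automorphisms M" and g: "g \<in> mp_automorphisms M"
    let ?S = "space M"
    have b: "f \<in> Bij ?S" "g \<in> Bij ?S" and bb: "bij_betw f ?S ?S" "bij_betw g ?S ?S"
      and m: "f \<in> measurable M M" "g \<in> measurable M M"
      and mi: "inv_into ?S f \<in> measurable M M" "inv_into ?S g \<in> measurable M M"
      and d: "distr M M f = M" "distr M M g = M"
      using f g by (auto simp: mp_automorphisms_def Bij_def)
    have c: "compose ?S f g \<in> Bij ?S" by (rule compose_Bij[OF b])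
    have cm: "compose ?S f g \<in> measurable M M"
      using measurable_comp[OF m(2) m(1)]
      by (subst measurable_cong[where g = "f \<circ> g"]) (auto simp: compose_def)
    have "inv_into ?S (compose ?S f g) x = inv_into ?S g (inv_into ?S f x)" if x: "x \<in> ?S" for x
    proof -
      have p: "inv_into ?S f x \<in> ?S" "f (inv_into ?S f x) = x"
        using x bb(1) by (auto simp: bij_betw_def inv_into_into f_inv_into_f)
      have q: "inv_into ?S g (inv_into ?S f x) \<in> ?S"
          "g (inv_into ?S g (inv_into ?S f x)) = inv_into ?S f x"
        using p(1) bb(2) by (auto simp: bij_betw_def inv_into_into f_inv_into_f)
      show ?thesis
        by (rule inv_into_f_eq) (use c p q in \<open>auto simp: Bij_def bij_betw_def compose_def\<close>)
    qed
    then have cim: "inv_into ?S (compose ?S f g) \<in> measurable M M"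
      using measurable_comp[OF mi(1) mi(2)]
      by (subst measurable_cong[where g = "inv_into ?S g \<circ> inv_into ?S f"]) auto
    have "distr M M (compose ?S f g) = distr M M (f \<circ> g)"
      by (rule distr_cong) (auto simp: compose_def)
    also have "\<dots> = M" using distr_distr[OF m(1) m(2)] d by simp
    finally show "f \<otimes>\<^bsub>BijGroup ?S\<^esub> g \<in> mp_automorphisms M"
      using c cm cim b by (simp add: mp_automorphisms_def BijGroup_def)
  qed
qed

lemma mp_aut_group_is_group: "group (mp_aut_group M)"
  unfolding mp_aut_group_def
  by (rule subgroup.subgroup_is_group[OF mp_automorphisms_subgroup group_BijGroup])

text \<open>Free groups of every rank exist: let the letters act on reduced words by left
  multiplication.\<close>

definition cancel_cons :: "letter \<Rightarrow> letter list \<Rightarrow> letter list"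
  where "cancel_cons a w = (if w \<noteq> [] \<and> hd w = inverse_letter a then tl w else a # w)"

lemma inverse_letter_inverse [simp]: "inverse_letter (inverse_letter a) = a"
  by (simp add: inverse_letter_def)

lemma reduced_Cons:
  "reduced (a # w) \<longleftrightarrow> reduced w \<and> (w \<noteq> [] \<longrightarrow> hd w \<noteq> inverse_letter a)"
  unfolding reduced_def
  by (cases w) (auto simp: nth_Cons split: nat.splits)

lemma reduced_cancel_cons: "reduced w \<Longrightarrow> reduced (cancel_cons a w)"
  by (cases w) (auto simp: cancel_cons_def reduced_Cons)

lemma cancel_cons_inverse:
  "reduced w \<Longrightarrow> cancel_cons (inverse_letter a) (cancel_cons a w) = w"
  by (cases w) (auto simp: cancel_cons_def reduced_Cons split: if_splits)

lemma free_group_rank_exists: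
  "\<exists>(G :: (letter list \<Rightarrow> letter list) monoid) s. free_group_rank G s r"
proof -
  define R where "R = Collect reduced"
  define A where "A = (\<lambda>a. restrict (cancel_cons a) R)"
  define s where "s = (\<lambda>i. A (i, True))"
  define P where "P = BijGroup R"
  define C where "C = generate P (s ` {1..r})"
  define G where "G = P \<lparr>carrier := C\<rparr>"
  interpret P: group P unfolding P_def by (rule group_BijGroup)
  have AB: "A a \<in> Bij R" for a
  proof -
    have "bij_betw (A a) R R"
    proof (rule bij_betw_byWitness[where f' = "A (inverse_letter a)"])
      show "\<forall>w\<in>R. A (inverse_letter a) (A a w) = w"
        by (auto simp: A_def R_def reduced_cancel_cons cancel_cons_inverse)
      show "\<forall>w\<in>R. A a (A (inverse_letter a) w) = w"
        using cancel_cons_inverse[where a = "inverse_letter a"]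
        by (auto simp: A_def R_def reduced_cancel_cons)
    qed (auto simp: A_def R_def reduced_cancel_cons)
    then show ?thesis by (simp add: Bij_def A_def)
  qed
  have AP: "A a \<in> carrier P" for a using AB by (simp add: P_def BijGroup_def)
  have mP: "A a \<otimes>\<^bsub>P\<^esub> f = compose R (A a) f" if "f \<in> carrier P" for a f
    using that AB by (simp add: P_def BijGroup_def)
  have oP: "\<one>\<^bsub>P\<^esub> = (\<lambda>w\<in>R. w)" by (simp add: P_def BijGroup_def)
  have sub: "subgroup C P"
    unfolding C_def by (rule P.generate_is_subgroup) (use AP in \<open>auto simp: s_def\<close>)
  have gG: "group G" unfolding G_def by (rule subgroup.subgroup_is_group[OF sub P.group_axioms])
  have sC: "s ` {1..r} \<subseteq> C" unfolding C_def by (auto intro: generate.incl)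
  have invA: "inv\<^bsub>P\<^esub> (A a) = A (inverse_letter a)" for a
  proof (rule P.inv_equality)
    show "A (inverse_letter a) \<otimes>\<^bsub>P\<^esub> A a = \<one>\<^bsub>P\<^esub>"
      unfolding mP[OF AP] oP
      by (rule ext) (auto simp: compose_def A_def R_def reduced_cancel_cons cancel_cons_inverse)
  qed (rule AP)+
  have lv: "letter_value G s a = A a" if "fst a \<in> {1..r}" for a
  proof (cases a)
    case (Pair i b)
    have "inv\<^bsub>G\<^esub> (s i) = inv\<^bsub>P\<^esub> (s i)"
      unfolding G_def by (rule P.m_inv_consistent[OF sub]) (use that Pair sC in auto)
    then show ?thesis
      using Pair invA[of "(i, True)"] by (auto simp: letter_value_def s_def inverse_letter_def)
  qed
  have wv: "word_value G s w \<in> carrier P \<and> (\<forall>v\<in>R. word_value G s w v = foldr cancel_cons w v)"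
    if "fst ` set w \<subseteq> {1..r}" for w
    using that
  proof (induction w)
    case Nil
    have "word_value G s [] = \<one>\<^bsub>P\<^esub>" by (simp add: word_value_def G_def)
    moreover have "\<forall>v\<in>R. \<one>\<^bsub>P\<^esub> v = foldr cancel_cons [] v" by (simp add: oP)
    ultimately show ?case by simp
  next
    case (Cons a w)
    then have IH: "word_value G s w \<in> carrier P" "\<And>v. v \<in> R \<Longrightarrow> word_value G s w v = foldr cancel_cons w v"
      by auto
    have "word_value G s (a # w) = A a \<otimes>\<^bsub>P\<^esub> word_value G s w"
      using lv[of a] Cons.prems by (simp add: word_value_def) (simp add: G_def)
    moreover have "foldr cancel_cons w v \<in> R" if "v \<in> R" for v
      using that by (induction w) (auto simp: R_def reduced_cancel_cons)
    then have "\<forall>v\<in>R. (A a \<otimes>\<^bsub>P\<^esub> word_value G s w) v = foldr cancel_cons (a # w) v"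
      using mP[OF IH(1)] IH(2) by (simp add: compose_def A_def)
    ultimately show ?case
      using P.m_closed[OF AP IH(1)] by simp
  qed
  have fold: "foldr cancel_cons w [] = w" if "reduced w" for w
    using that by (induction w) (auto simp: reduced_Cons cancel_cons_def)
  have "word_value G s w \<noteq> \<one>\<^bsub>G\<^esub>"
    if w: "reduced w" "w \<noteq> []" "fst ` set w \<subseteq> {1..r}" for w
  proof
    assume eq: "word_value G s w = \<one>\<^bsub>G\<^esub>"
    have N: "[] \<in> R" by (simp add: R_def reduced_def)
    have "w = word_value G s w []" using wv[OF w(3)] N fold[OF w(1)] by auto
    also have "\<dots> = []" unfolding eq using N by (simp add: G_def oP)
    finally show False using w(2) by simp
  qed
  moreover have "generate G (s ` {1..r}) = C"
    unfolding G_def using P.generate_consistent[OF sC sub] C_def by simp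
  ultimately have "free_group_rank G s r"
    using gG sC by (simp add: free_group_rank_def) (simp add: G_def)
  then show ?thesis by blast
qed

end

theory Submission
  imports Defs
begin

text \<open>The distance \<open>d0_star\<close> looks only at the joint laws \<open>p i\<close> of \<open>\<beta>\<close> and \<open>\<beta> \<circ> T (s i)\<close>, one generator
  at a time. Since the group is free, the permutations by which the generators act on \<open>{1..n}\<close> can be
  chosen independently of each other (\<open>free_group_universal_property\<close>). So it is enough to find one
  labeling \<open>y\<close> of \<open>{1..n}\<close> and, for each \<open>i\<close> separately, a permutation \<open>\<tau>\<close> such that the pairs
  \<open>(y j, y (\<tau> j))\<close> are distributed almost like \<open>p i\<close>.

  What makes a common \<open>y\<close> possible is invariance of the measure: both marginals of every \<open>p i\<close> are the
  law \<open>q\<close> of \<open>\<beta>\<close> (\<open>joint_law_marginals\<close>). Round \<open>n * p i\<close> down to a multiset of pairs. Its two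
  projections are then contained in the rounding of \<open>n * q\<close>, hence in any multiset \<open>N\<close> of size \<open>n\<close> that
  contains this rounding; let \<open>y\<close> be an enumeration of such an \<open>N\<close>. Pairing the unmatched labels
  arbitrarily extends the rounded multiset to a coupling of \<open>N\<close> with itself (\<open>couple_leftovers\<close>),
  and every such coupling comes from a permutation (\<open>coupling_permutation\<close>).

  The arbitrary pairing does no harm: every pair has frequency at least its \<open>p i\<close>-probability minus
  \<open>1 / n\<close>, and because frequencies and probabilities both add up to 1, this one-sided estimate bounds
  the total variation distance by \<open>card B ^ 2 / n\<close> (\<open>l1_dist_le_of_one_sided\<close>). Summing over the
  generators gives \<open>finite_model_with_error_bound\<close>.\<close>

section \<open>The universal property of free groups\<close>

lemma letter_value_closed:
  assumes "group G" "s ` I \<subseteq> carrier G" "fst a \<in> I"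
  shows "letter_value G s a \<in> carrier G"
  using assms by (auto simp: letter_value_def intro: group.inv_closed)

lemma word_value_simps [simp]:
  "word_value G s [] = \<one>\<^bsub>G\<^esub>"
  "word_value G s (a # w) = letter_value G s a \<otimes>\<^bsub>G\<^esub> word_value G s w"
  by (simp_all add: word_value_def)

lemma word_value_closed:
  assumes "group G" "s ` I \<subseteq> carrier G" "fst ` set w \<subseteq> I"
  shows "word_value G s w \<in> carrier G"
proof -
  interpret group G by fact
  show ?thesis
    using assms(3) by (induction w) (auto intro!: m_closed letter_value_closed[OF assms(1,2)])
qed

lemma word_value_append:
  assumes "group G" "s ` I \<subseteq> carrier G" "fst ` set u \<subseteq> I" "fst ` set v \<subseteq> I"
  shows "word_value G s (u @ v) = word_value G s u \<otimes>\<^bsub>G\<^esub> word_value G s v"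
proof -
  interpret group G by fact
  note closed = letter_value_closed[OF assms(1,2)] word_value_closed[OF assms(1,2)]
  show ?thesis
    using assms(3,4) by (induction u) (auto simp: closed m_assoc)
qed

lemma letter_value_inverse_letter:
  assumes "group G" "s ` I \<subseteq> carrier G" "fst a \<in> I"
  shows "letter_value G s (inverse_letter a) = inv\<^bsub>G\<^esub> (letter_value G s a)"
proof -
  interpret group G by fact
  have "s (fst a) \<in> carrier G" using assms by auto
  then show ?thesis by (simp add: letter_value_def inverse_letter_def)
qed

lemma fst_inverse_letter [simp]: "fst (inverse_letter a) = fst a"
  by (simp add: inverse_letter_def)

lemma word_value_inverse:
  assumes "group G" "s ` I \<subseteq> carrier G" "fst ` set w \<subseteq> I"
  shows "word_value G s (rev (map inverse_letter w)) = inv\<^bsub>G\<^esub> (word_value G s w)"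
proof -
  interpret group G by fact
  note closed = letter_value_closed[OF assms(1,2)] word_value_closed[OF assms(1,2)]
  show ?thesis
    using assms(3)
  proof (induction w)
    case (Cons a w)
    have "word_value G s (rev (map inverse_letter w) @ [inverse_letter a]) =
        word_value G s (rev (map inverse_letter w)) \<otimes>\<^bsub>G\<^esub> word_value G s [inverse_letter a]"
      by (rule word_value_append[OF assms(1,2)]) (use Cons.prems in \<open>auto simp: image_iff\<close>)
    with Cons show ?case
      by (simp add: closed letter_value_inverse_letter[OF assms(1,2)] inv_mult_group)
  qed simp
qed

lemma not_reduced_split:
  assumes "\<not> reduced w"
  obtains u a v where "w = u @ a # inverse_letter a # v"
proof -
  obtain k where k: "Suc k < length w" "w ! Suc k = inverse_letter (w ! k)"
    using assms by (auto simp: reduced_def)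
  have "w = take k w @ w ! k # w ! Suc k # drop (Suc (Suc k)) w"
    using k(1) by (simp add: Cons_nth_drop_Suc)
  with k(2) that show thesis by metis
qed

text \<open>Deleting a cancelling pair of letters changes the value in no group, and a word that is trivial
  in the free group admits such deletions until nothing is left.\<close>

lemma trivial_word_value_transfer:
  assumes G: "free_group_rank G s r" and H: "group H" "t ` {1..r} \<subseteq> carrier H"
    and w: "fst ` set w \<subseteq> {1..r}" "word_value G s w = \<one>\<^bsub>G\<^esub>"
  shows "word_value H t w = \<one>\<^bsub>H\<^esub>"
  using w
proof (induction w rule: length_induct)
  case (1 w)
  have gG: "group G" "s ` {1..r} \<subseteq> carrier G" using G by (auto simp: free_group_rank_def)
  show ?case
  proof (cases "w = []")
    case False
    with 1 G have "\<not> reduced w" unfolding free_group_rank_def by blast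
    then obtain u a v where split: "w = u @ a # inverse_letter a # v" by (rule not_reduced_split)
    have letters: "fst ` set u \<subseteq> {1..r}" "fst ` set v \<subseteq> {1..r}" "fst a \<in> {1..r}"
      using 1(2) split by auto
    have delete: "word_value K k w = word_value K k (u @ v)"
      if K: "group K" "k ` {1..r} \<subseteq> carrier K" for K :: "('k, 'l) monoid_scheme" and k
    proof -
      interpret K: group K by fact
      have lk: "letter_value K k a \<in> carrier K"
        by (rule letter_value_closed[OF K]) (rule letters)
      have wk: "word_value K k v \<in> carrier K"
        by (rule word_value_closed[OF K]) (rule letters)
      have "word_value K k (a # inverse_letter a # v) = word_value K k v"
        using lk wk letter_value_inverse_letter[OF K letters(3)]
        by (simp add: K.m_assoc[symmetric])
      moreover have "word_value K k w =
          word_value K k u \<otimes>\<^bsub>K\<^esub> word_value K k (a # inverse_letter a # v)"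
        unfolding split by (rule word_value_append[OF K]) (use letters in auto)
      moreover have "word_value K k (u @ v) = word_value K k u \<otimes>\<^bsub>K\<^esub> word_value K k v"
        by (rule word_value_append[OF K letters(1,2)])
      ultimately show ?thesis by simp
    qed
    have "word_value H t (u @ v) = \<one>\<^bsub>H\<^esub>"
      using 1 delete[OF gG] letters split by auto
    then show ?thesis using delete[OF H] by simp
  qed simp
qed

lemma generate_word_value:
  assumes "group G" "s ` I \<subseteq> carrier G" "g \<in> generate G (s ` I)"
  shows "\<exists>w. fst ` set w \<subseteq> I \<and> word_value G s w = g"
proof -
  interpret group G by fact
  show ?thesis
    using assms(3)
  proof induction
    case one
    show ?case by (rule exI[of _ "[]"]) simp
  next
    case (incl h)
    then obtain i where "i \<in> I" "h = s i" by auto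
    then show ?case
      using assms(2) by (intro exI[of _ "[(i, True)]"]) (auto simp: letter_value_def)
  next
    case (inv h)
    then obtain i where "i \<in> I" "h = s i" by auto
    then show ?case
      using assms(2) by (intro exI[of _ "[(i, False)]"]) (auto simp: letter_value_def)
  next
    case (eng g h)
    then obtain u v where "fst ` set u \<subseteq> I" "word_value G s u = g"
      "fst ` set v \<subseteq> I" "word_value G s v = h" by auto
    then show ?case
      using word_value_append[OF assms(1,2)] by (intro exI[of _ "u @ v"]) auto
  qed
qed

text \<open>The extension sends the value of a word in the free generators to the value of the same word in
  \<open>t\<close>. Two words \<open>u\<close>, \<open>w\<close> with equal value give the same result, by \<open>trivial_word_value_transfer\<close> for
  \<open>u\<close> followed by the formal inverse of \<open>w\<close>.\<close>

lemma free_group_universal_property: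
  assumes G: "free_group_rank G s r" and H: "group H" "t ` {1..r} \<subseteq> carrier H"
  obtains \<phi> where "\<phi> \<in> hom G H" "\<And>i. i \<in> {1..r} \<Longrightarrow> \<phi> (s i) = t i"
proof -
  have gG: "group G" "s ` {1..r} \<subseteq> carrier G" "generate G (s ` {1..r}) = carrier G"
    using G by (auto simp: free_group_rank_def)
  interpret G: group G by fact
  interpret H: group H by fact
  define word where
    "word = (\<lambda>g. SOME w. fst ` set w \<subseteq> {1..r} \<and> word_value G s w = g)"
  have word: "fst ` set (word g) \<subseteq> {1..r}" "word_value G s (word g) = g" if "g \<in> carrier G" for g
    using someI_ex[OF generate_word_value[OF gG(1,2)], of g] that gG(3)
    unfolding word_def by auto
  define \<phi> where "\<phi> = (\<lambda>g. word_value H t (word g))"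
  have \<phi>: "\<phi> (word_value G s w) = word_value H t w" if w: "fst ` set w \<subseteq> {1..r}" for w
  proof -
    let ?w' = "word (word_value G s w)"
    let ?u = "?w' @ rev (map inverse_letter w)"
    have c: "word_value G s w \<in> carrier G" by (rule word_value_closed[OF gG(1,2) w])
    note w' = word[OF c]
    have winv: "fst ` set (rev (map inverse_letter w)) \<subseteq> {1..r}"
      using w by (simp add: image_image)
    have u: "fst ` set ?u \<subseteq> {1..r}"
      using w'(1) winv unfolding set_append image_Un by blast
    have "word_value G s ?u = \<one>\<^bsub>G\<^esub>"
      using word_value_append[OF gG(1,2) w'(1) winv] word_value_inverse[OF gG(1,2) w] w'(2) c
      by simp
    then have "word_value H t ?u = \<one>\<^bsub>H\<^esub>"
      by (rule trivial_word_value_transfer[OF G H u])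
    then have "word_value H t ?w' \<otimes>\<^bsub>H\<^esub> inv\<^bsub>H\<^esub> (word_value H t w) = \<one>\<^bsub>H\<^esub>"
      using word_value_append[OF H w'(1) winv] word_value_inverse[OF H w] by simp
    then show ?thesis
      using word_value_closed[OF H w] word_value_closed[OF H w'(1)] unfolding \<phi>_def
      by (metis H.inv_closed H.inv_equality H.inv_inv)
  qed
  have "\<phi> \<in> hom G H"
  proof (rule homI)
    show "\<phi> g \<in> carrier H" if "g \<in> carrier G" for g
      unfolding \<phi>_def by (rule word_value_closed[OF H word(1)[OF that]])
    show "\<phi> (g \<otimes>\<^bsub>G\<^esub> h) = \<phi> g \<otimes>\<^bsub>H\<^esub> \<phi> h" if "g \<in> carrier G" "h \<in> carrier G" for g h
    proof -
      note wg = word[OF that(1)] and wh = word[OF that(2)]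
      have "g \<otimes>\<^bsub>G\<^esub> h = word_value G s (word g @ word h)"
        using word_value_append[OF gG(1,2) wg(1) wh(1)] wg(2) wh(2) by simp
      then have "\<phi> (g \<otimes>\<^bsub>G\<^esub> h) = word_value H t (word g @ word h)"
        using \<phi>[of "word g @ word h"] wg(1) wh(1) by auto
      then show ?thesis
        using word_value_append[OF H wg(1) wh(1)] by (simp add: \<phi>_def)
    qed
  qed
  moreover have "\<phi> (s i) = t i" if "i \<in> {1..r}" for i
  proof -
    have "s i \<in> carrier G" "t i \<in> carrier H" using that gG(2) H(2) by auto
    then show ?thesis
      using \<phi>[of "[(i, True)]"] that by (simp add: letter_value_def)
  qed
  ultimately show thesis by (rule that)
qed

section \<open>Realizing couplings by permutations\<close>

text \<open>As many elements of \<open>N\<close> are missing among the first entries as among the second, so the missing ones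
  can be paired off in any order.\<close>

lemma couple_leftovers:
  fixes Q :: "('a \<times> 'a) multiset"
  assumes "image_mset fst Q \<subseteq># N" "image_mset snd Q \<subseteq># N"
  obtains Q' where "Q \<subseteq># Q'" "image_mset fst Q' = N" "image_mset snd Q' = N"
proof -
  obtain xs zs where xs: "mset xs = N - image_mset fst Q" and zs: "mset zs = N - image_mset snd Q"
    using ex_mset by metis
  have "length xs = length zs"
    using arg_cong[OF xs, of size] arg_cong[OF zs, of size] assms
    by (simp add: size_Diff_submset)
  then have "image_mset fst (mset (zip xs zs)) = mset xs" "image_mset snd (mset (zip xs zs)) = mset zs"
    by (metis map_fst_zip mset_map, metis map_snd_zip mset_map)
  then show thesis
    using assms xs zs by (intro that[of "Q + mset (zip xs zs)"]) auto
qed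

lemma multiset_enumeration:
  assumes "finite A" "size Q = card A"
  obtains q where "image_mset q (mset_set A) = Q"
proof -
  obtain xs where xs: "mset xs = Q" using ex_mset by metis
  obtain h where h: "bij_betw h A {..<card A}"
    using assms(1) by (metis ex_bij_betw_finite_nat atLeast0LessThan)
  have "image_mset ((!) xs) (image_mset h (mset_set A)) = image_mset ((!) xs) (mset_set {..<card A})"
    using h by (simp add: bij_betw_def image_mset_mset_set)
  also have "\<dots> = mset xs"
    using arg_cong[OF xs, of size] assms(2) mset_map[of "(!) xs" "[0..<length xs]"]
    by (metis map_nth mset_upt size_mset atLeast0LessThan)
  finally have "image_mset ((!) xs \<circ> h) (mset_set A) = Q"
    using xs by (simp add: multiset.map_comp)
  then show thesis by (rule that)
qed

text \<open>Enumerate the pairs of \<open>Q\<close> by \<open>A\<close>. The list of first entries and the list of second entries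
  are both rearrangements of \<open>y\<close>; the wanted permutation is the one that takes the first
  rearrangement to the second.\<close>

lemma coupling_permutation:
  fixes y :: "'a \<Rightarrow> 'b"
  assumes A: "finite A"
    and "image_mset fst Q = image_mset y (mset_set A)"
    and "image_mset snd Q = image_mset y (mset_set A)"
  obtains \<tau> where "\<tau> permutes A" "image_mset (\<lambda>j. (y j, y (\<tau> j))) (mset_set A) = Q"
proof -
  have "size Q = card A"
    using arg_cong[OF assms(2), of size] by simp
  then obtain q where q: "image_mset q (mset_set A) = Q"
    using multiset_enumeration[OF A] by metis
  have "image_mset y (mset_set A) = image_mset (fst \<circ> q) (mset_set A)"
    "image_mset y (mset_set A) = image_mset (snd \<circ> q) (mset_set A)"
    using assms(2,3) q by (simp_all flip: multiset.map_comp)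
  then obtain p1 p2 where p1: "p1 permutes A" "\<forall>x\<in>A. y x = (fst \<circ> q) (p1 x)"
    and p2: "p2 permutes A" "\<forall>x\<in>A. y x = (snd \<circ> q) (p2 x)"
    using image_mset_eq_implies_permutes[OF A] by metis
  \<comment> \<open>\<open>p1\<close> places \<open>j\<close> at a pair with first entry \<open>y j\<close>; \<open>\<tau> j\<close> is the point that \<open>p2\<close> places at the
    same pair, so \<open>y (\<tau> j)\<close> is its second entry.\<close>
  let ?\<tau> = "inv_into UNIV p2 \<circ> p1"
  have \<tau>: "?\<tau> permutes A"
    using p1(1) p2(1) by (intro permutes_compose permutes_inv)
  have "(y j, y (?\<tau> j)) = q (p1 j)" if "j \<in> A" for j
  proof -
    have "?\<tau> j \<in> A" using permutes_in_image[OF \<tau>] that by blast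
    then have "y (?\<tau> j) = snd (q (p1 j))"
      using p2 by (simp add: permutes_inverses(1)[OF p2(1)])
    then show ?thesis using p1(2) that by (simp add: prod_eq_iff)
  qed
  then have "image_mset (\<lambda>j. (y j, y (?\<tau> j))) (mset_set A) = image_mset (\<lambda>j. q (p1 j)) (mset_set A)"
    using A by (intro image_mset_cong) auto
  also have "\<dots> = image_mset q (image_mset p1 (mset_set A))"
    by (simp add: multiset.map_comp comp_def)
  also have "image_mset p1 (mset_set A) = mset_set A"
    using permutes_inj_on[OF p1(1)] permutes_image[OF p1(1)] by (simp add: image_mset_mset_set)
  finally show thesis using \<tau> q that by metis
qed

section \<open>Rounding a coupling\<close>

definition floor_mset :: "'a set \<Rightarrow> ('a \<Rightarrow> real) \<Rightarrow> 'a multiset"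
  where "floor_mset A f = (\<Sum>x\<in>A. replicate_mset (nat \<lfloor>f x\<rfloor>) x)"

lemma count_floor_mset:
  assumes "finite A"
  shows "count (floor_mset A f) x = (if x \<in> A then nat \<lfloor>f x\<rfloor> else 0)"
  using assms by (simp add: floor_mset_def count_sum)

lemma size_floor_mset: "size (floor_mset A f) = (\<Sum>x\<in>A. nat \<lfloor>f x\<rfloor>)"
  by (simp add: floor_mset_def)

lemma sum_nat_floor_le:
  fixes f :: "'a \<Rightarrow> real"
  assumes "\<And>x. x \<in> A \<Longrightarrow> f x \<ge> 0"
  shows "(\<Sum>x\<in>A. nat \<lfloor>f x\<rfloor>) \<le> nat \<lfloor>\<Sum>x\<in>A. f x\<rfloor>"
proof -
  have "real (\<Sum>x\<in>A. nat \<lfloor>f x\<rfloor>) \<le> (\<Sum>x\<in>A. f x)"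
    unfolding of_nat_sum using assms by (intro sum_mono) simp
  then show ?thesis by (simp add: le_nat_floor)
qed

text \<open>Rounding down commutes with pushing forward up to inclusion, because a sum of floors is at most the
  floor of the sum. Used with \<open>h\<close> the projections of a product.\<close>

lemma image_floor_mset_subseteq:
  assumes "finite A" "finite C" "h ` A \<subseteq> C" "\<And>x. x \<in> A \<Longrightarrow> f x \<ge> 0"
    and "\<And>c. c \<in> C \<Longrightarrow> (\<Sum>x\<in>{x \<in> A. h x = c}. f x) = g c"
  shows "image_mset h (floor_mset A f) \<subseteq># floor_mset C g"
proof (rule mset_subset_eqI)
  fix c
  have "image_mset h (floor_mset A f) = (\<Sum>x\<in>A. replicate_mset (nat \<lfloor>f x\<rfloor>) (h x))"
    using assms(1) unfolding floor_mset_def by (induction A) auto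
  then have "count (image_mset h (floor_mset A f)) c = (\<Sum>x\<in>{x \<in> A. h x = c}. nat \<lfloor>f x\<rfloor>)"
    using assms(1) by (simp add: count_sum sum.inter_filter) (rule sum.cong, auto)
  also have "\<dots> \<le> count (floor_mset C g) c"
  proof (cases "c \<in> C")
    case True
    have "(\<Sum>x\<in>{x \<in> A. h x = c}. nat \<lfloor>f x\<rfloor>) \<le> nat \<lfloor>\<Sum>x\<in>{x \<in> A. h x = c}. f x\<rfloor>"
      using assms(4) by (intro sum_nat_floor_le) auto
    then show ?thesis using assms(2,5) True by (simp add: count_floor_mset)
  next
    case False
    then have "{x \<in> A. h x = c} = {}" using assms(3) by auto
    then show ?thesis by (simp only: sum.empty)
  qed
  finally show "count (image_mset h (floor_mset A f)) c \<le> count (floor_mset C g) c" .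
qed

text \<open>One labeling \<open>y\<close> serves all the couplings \<open>p i\<close> of \<open>q\<close> with itself, since the multiset of labels
  is chosen from \<open>q\<close> alone. The error \<open>1\<close> is the loss from rounding \<open>card A * p i ab\<close> down;
  completing the coupling can only raise the counts.\<close>

lemma labeling_with_permutations:
  fixes p :: "'i \<Rightarrow> 'b \<times> 'b \<Rightarrow> real" and q :: "'b \<Rightarrow> real" and B :: "'b set"
  assumes B: "finite B" and A: "finite A" "A \<noteq> {}"
    and q: "\<And>a. a \<in> B \<Longrightarrow> q a \<ge> 0" "(\<Sum>a\<in>B. q a) = 1"
    and p: "\<And>i ab. i \<in> I \<Longrightarrow> ab \<in> B \<times> B \<Longrightarrow> p i ab \<ge> 0"
    and row: "\<And>i a. i \<in> I \<Longrightarrow> a \<in> B \<Longrightarrow> (\<Sum>b\<in>B. p i (a, b)) = q a"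
    and col: "\<And>i b. i \<in> I \<Longrightarrow> b \<in> B \<Longrightarrow> (\<Sum>a\<in>B. p i (a, b)) = q b"
  obtains y \<tau> where "y \<in> A \<rightarrow>\<^sub>E B" "\<And>i. i \<in> I \<Longrightarrow> \<tau> i permutes A"
    "\<And>i ab. i \<in> I \<Longrightarrow> ab \<in> B \<times> B \<Longrightarrow>
      real (card A) * p i ab - 1 \<le> real (card {j \<in> A. (y j, y (\<tau> i j)) = ab})"
proof -
  define n where "n = card A"
  obtain b0 where b0: "b0 \<in> B" using q(2) by (metis all_not_in_conv sum.empty zero_neq_one)
  \<comment> \<open>\<open>N0\<close> may have fewer than \<open>n\<close> elements; copies of an arbitrary label fill the gap.\<close>
  define N0 where "N0 = floor_mset B (\<lambda>a. real n * q a)"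
  define N where "N = N0 + replicate_mset (n - size N0) b0"
  have "size N0 \<le> nat \<lfloor>\<Sum>a\<in>B. real n * q a\<rfloor>"
    unfolding N0_def size_floor_mset using q(1) by (intro sum_nat_floor_le) auto
  also have "\<dots> = n" using q(2) by (simp flip: sum_distrib_left)
  finally have size_N: "size N = card A" by (simp add: N_def n_def)
  have set_N: "set_mset N \<subseteq> B"
    using b0 by (auto simp: N_def N0_def floor_mset_def B set_mset_sum in_replicate_mset)
  obtain y0 where y0: "image_mset y0 (mset_set A) = N"
    using multiset_enumeration[OF A(1) size_N] by metis
  define y where "y = restrict y0 A"
  have y: "image_mset y (mset_set A) = N"
    unfolding y0[symmetric] using A(1) by (intro image_mset_cong) (simp add: y_def)
  have "y0 ` A = set_mset N" using A(1) by (simp flip: y0)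
  then have yB: "y \<in> A \<rightarrow>\<^sub>E B" using set_N by (auto simp: y_def)
  have "\<exists>\<tau>. \<tau> permutes A \<and> (\<forall>ab\<in>B \<times> B.
      real n * p i ab - 1 \<le> real (card {j \<in> A. (y j, y (\<tau> j)) = ab}))" if i: "i \<in> I" for i
  proof -
    define Q where "Q = floor_mset (B \<times> B) (\<lambda>ab. real n * p i ab)"
    have nonneg: "real n * p i ab \<ge> 0" if "ab \<in> B \<times> B" for ab
      using p[OF i that] by simp
    have "image_mset fst Q \<subseteq># N0"
      unfolding Q_def N0_def
    proof (rule image_floor_mset_subseteq)
      fix a assume a: "a \<in> B"
      then have "{ab \<in> B \<times> B. fst ab = a} = Pair a ` B" by auto
      then have "(\<Sum>ab\<in>{ab \<in> B \<times> B. fst ab = a}. p i ab) = q a"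
        using row[OF i a] by (simp add: sum.reindex inj_on_def)
      then show "(\<Sum>ab\<in>{ab \<in> B \<times> B. fst ab = a}. real n * p i ab) = real n * q a"
        by (simp flip: sum_distrib_left)
    qed (use B nonneg in auto)
    moreover have "image_mset snd Q \<subseteq># N0"
      unfolding Q_def N0_def
    proof (rule image_floor_mset_subseteq)
      fix b assume b: "b \<in> B"
      then have "{ab \<in> B \<times> B. snd ab = b} = (\<lambda>a. (a, b)) ` B" by auto
      then have "(\<Sum>ab\<in>{ab \<in> B \<times> B. snd ab = b}. p i ab) = q b"
        using col[OF i b] by (simp add: sum.reindex inj_on_def)
      then show "(\<Sum>ab\<in>{ab \<in> B \<times> B. snd ab = b}. real n * p i ab) = real n * q b"
        by (simp flip: sum_distrib_left)
    qed (use B nonneg in auto)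
    moreover have "N0 \<subseteq># N" by (simp add: N_def)
    ultimately obtain Q' where Q': "Q \<subseteq># Q'" "image_mset fst Q' = N" "image_mset snd Q' = N"
      using couple_leftovers subset_mset.order_trans by metis
    obtain \<tau> where \<tau>: "\<tau> permutes A" "image_mset (\<lambda>j. (y j, y (\<tau> j))) (mset_set A) = Q'"
      using coupling_permutation[OF A(1), of Q' y] Q'(2,3) y by metis
    have "real n * p i ab - 1 \<le> real (card {j \<in> A. (y j, y (\<tau> j)) = ab})"
      if ab: "ab \<in> B \<times> B" for ab
    proof -
      have "real n * p i ab - 1 \<le> real (count Q ab)"
        using ab B nonneg[OF ab] unfolding Q_def by (simp add: count_floor_mset)
      also have "count Q ab \<le> count Q' ab" using Q'(1) by (rule mset_subset_eq_count)
      also have "count Q' ab = card {j \<in> A. (y j, y (\<tau> j)) = ab}"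
        unfolding \<tau>(2)[symmetric] by (rule count_image_mset_eq_card_vimage[OF A(1)])
      finally show ?thesis by simp
    qed
    with \<tau>(1) show ?thesis by blast
  qed
  then have "\<forall>i\<in>I. \<exists>\<tau>. \<tau> permutes A \<and> (\<forall>ab\<in>B \<times> B.
      real n * p i ab - 1 \<le> real (card {j \<in> A. (y j, y (\<tau> j)) = ab}))" ..
  from bchoice[OF this] obtain \<tau> where "\<forall>i\<in>I. \<tau> i permutes A \<and> (\<forall>ab\<in>B \<times> B.
      real n * p i ab - 1 \<le> real (card {j \<in> A. (y j, y (\<tau> i j)) = ab}))" ..
  with yB show thesis by (intro that[of y \<tau>]) (auto simp: n_def)
qed

text \<open>The positive and negative parts of \<open>u - v\<close> have the same sum, so it suffices to control one of
  them.\<close>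

lemma l1_dist_le_of_one_sided:
  fixes u v :: "'a \<Rightarrow> real"
  assumes "(\<Sum>x\<in>A. u x) = (\<Sum>x\<in>A. v x)" "\<And>x. x \<in> A \<Longrightarrow> v x - \<epsilon> \<le> u x" "\<epsilon> \<ge> 0"
  shows "(\<Sum>x\<in>A. \<bar>u x - v x\<bar>) \<le> 2 * real (card A) * \<epsilon>"
proof -
  have "(\<Sum>x\<in>A. \<bar>u x - v x\<bar>) \<le> (\<Sum>x\<in>A. (u x - v x) + 2 * \<epsilon>)"
  proof (rule sum_mono)
    fix x assume "x \<in> A"
    from assms(2)[OF this] assms(3) show "\<bar>u x - v x\<bar> \<le> (u x - v x) + 2 * \<epsilon>" by linarith
  qed
  also have "\<dots> = 2 * real (card A) * \<epsilon>"
    using assms(1) by (simp add: sum.distrib sum_subtractf)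
  finally show ?thesis .
qed

section \<open>Two-point marginals\<close>

lemma measure_marginal_two_points:
  assumes B: "finite B" and G: "e \<in> carrier G" "g \<in> carrier G"
    and meas: "\<And>h. h \<in> carrier G \<Longrightarrow> (\<lambda>x. y (S h x)) \<in> measurable N (count_space B)"
    and z: "z \<in> {e, g} \<rightarrow>\<^sub>E B"
  shows "measure (marginal B {e, g} (distr N (labelings G B) (observable_orbit G S y))) {z} =
    measure N {x \<in> space N. (y (S e x), y (S g x)) = (z e, z g)}"
proof -
  let ?H = "{e, g}"
  have orbit: "observable_orbit G S y \<in> measurable N (labelings G B)"
    unfolding labelings_def observable_orbit_def by (rule measurable_restrict) (rule meas)
  have restr: "(\<lambda>x. restrict x ?H) \<in> measurable (labelings G B) (PiM ?H (\<lambda>_. count_space B))"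
    unfolding labelings_def using G by (intro measurable_restrict_subset) auto
  have "PiM ?H (\<lambda>_. count_space B) = count_space (?H \<rightarrow>\<^sub>E B)"
    using B by (intro count_space_PiM_finite) (auto intro: countable_finite)
  then have sets: "{z} \<in> sets (PiM ?H (\<lambda>_. count_space B))" using z by simp
  have "measure (marginal B ?H (distr N (labelings G B) (observable_orbit G S y))) {z} =
      measure N (((\<lambda>x. restrict x ?H) \<circ> observable_orbit G S y) -` {z} \<inter> space N)"
    unfolding marginal_def distr_distr[OF restr orbit]
    by (rule measure_distr[OF measurable_comp[OF orbit restr] sets])
  also have "((\<lambda>x. restrict x ?H) \<circ> observable_orbit G S y) -` {z} \<inter> space N =
      {x \<in> space N. (y (S e x), y (S g x)) = (z e, z g)}"
  proof -
    have orbit_eq: "restrict (observable_orbit G S y x) ?H = z \<longleftrightarrow> y (S e x) = z e \<and> y (S g x) = z g" for x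
      using z G by (auto simp: fun_eq_iff observable_orbit_def restrict_def PiE_def extensional_def)
    show ?thesis
      unfolding set_eq_iff Int_iff vimage_eq mem_Collect_eq singleton_iff comp_apply orbit_eq prod.inject
      by blast
  qed
  finally show ?thesis .
qed

text \<open>Only an inequality: if \<open>e = g\<close>, the pairs \<open>(z e, z g)\<close> need not exhaust \<open>B \<times> B\<close>.\<close>

lemma marginal_dist_two_points_le:
  assumes B: "finite B" and G: "e \<in> carrier G" "g \<in> carrier G"
    and N: "\<And>h. h \<in> carrier G \<Longrightarrow> (\<lambda>x. y (S h x)) \<in> measurable N (count_space B)"
    and N': "\<And>h. h \<in> carrier G \<Longrightarrow> (\<lambda>x. y' (S' h x)) \<in> measurable N' (count_space B)"
  shows "marginal_dist B {e, g} (distr N (labelings G B) (observable_orbit G S y))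
      (distr N' (labelings G B) (observable_orbit G S' y')) \<le>
    1/2 * (\<Sum>ab\<in>B \<times> B. \<bar>measure N {x \<in> space N. (y (S e x), y (S g x)) = ab} -
      measure N' {x \<in> space N'. (y' (S' e x), y' (S' g x)) = ab}\<bar>)" (is "_ \<le> 1/2 * sum ?f _")
proof -
  let ?Z = "{e, g} \<rightarrow>\<^sub>E B" and ?h = "\<lambda>z. (z e, z g)"
  have inj: "inj_on ?h ?Z" by (rule inj_onI) (auto intro!: PiE_ext)
  have "(\<Sum>z\<in>?Z. ?f (?h z)) = sum ?f (?h ` ?Z)"
    using sum.reindex[OF inj, of ?f] by simp
  also have "\<dots> \<le> sum ?f (B \<times> B)"
    using B by (intro sum_mono2) auto
  moreover have "measure (marginal B {e, g} (distr N (labelings G B) (observable_orbit G S y))) {z} =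
      measure N {x \<in> space N. (y (S e x), y (S g x)) = (z e, z g)}"
    "measure (marginal B {e, g} (distr N' (labelings G B) (observable_orbit G S' y'))) {z} =
      measure N' {x \<in> space N'. (y' (S' e x), y' (S' g x)) = (z e, z g)}" if "z \<in> ?Z" for z
    using measure_marginal_two_points[where S = S and y = y, OF B G N that]
      measure_marginal_two_points[where S = S' and y = y', OF B G N' that] by blast+
  ultimately show ?thesis
    unfolding marginal_dist_def by simp
qed

text \<open>Both marginals of the joint law of \<open>\<beta>\<close> and \<open>\<beta> \<circ> f\<close> are the law of \<open>\<beta>\<close>, the second one because
  \<open>f\<close> preserves the measure.\<close>

lemma joint_law_marginals:
  assumes "prob_space M" "finite B" and \<beta>: "\<beta> \<in> measurable M (count_space B)"
    and f: "f \<in> measurable M M" "distr M M f = M"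
  defines "p \<equiv> \<lambda>ab. measure M {x \<in> space M. (\<beta> x, \<beta> (f x)) = ab}"
  defines "q \<equiv> \<lambda>a. measure M {x \<in> space M. \<beta> x = a}"
  shows "a \<in> B \<Longrightarrow> (\<Sum>b\<in>B. p (a, b)) = q a"
    and "b \<in> B \<Longrightarrow> (\<Sum>a\<in>B. p (a, b)) = q b"
    and "(\<Sum>a\<in>B. q a) = 1"
proof -
  interpret prob_space M by fact
  have \<beta>f: "(\<lambda>x. \<beta> (f x)) \<in> measurable M (count_space B)"
    using measurable_comp[OF f(1) \<beta>] by (simp add: comp_def)
  have set1: "{x \<in> space M. \<gamma> x = a} \<in> sets M"
    if "\<gamma> \<in> measurable M (count_space B)" "a \<in> B" for \<gamma> :: "_ \<Rightarrow> _" and a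
  proof -
    have "{x \<in> space M. \<gamma> x = a} = \<gamma> -` {a} \<inter> space M" by auto
    then show ?thesis using measurable_sets[OF that(1), of "{a}"] that(2) by simp
  qed
  have set2: "{x \<in> space M. (\<beta> x, \<beta> (f x)) = (a, b)} \<in> sets M" if "a \<in> B" "b \<in> B" for a b
  proof -
    have "{x \<in> space M. (\<beta> x, \<beta> (f x)) = (a, b)} =
        {x \<in> space M. \<beta> x = a} \<inter> {x \<in> space M. \<beta> (f x) = b}" by auto
    then show ?thesis using set1[OF \<beta> that(1)] set1[OF \<beta>f that(2)] by simp
  qed
  have inB: "\<beta> x \<in> B" "\<beta> (f x) \<in> B" if "x \<in> space M" for x
    using measurable_space[OF \<beta> that] measurable_space[OF \<beta>f that] by simp_all
  show "(\<Sum>b\<in>B. p (a, b)) = q a" if a: "a \<in> B" for a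
  proof -
    have "(\<Sum>b\<in>B. p (a, b)) = measure M (\<Union>b\<in>B. {x \<in> space M. (\<beta> x, \<beta> (f x)) = (a, b)})"
      unfolding p_def using set2 a assms(2)
      by (intro finite_measure_finite_Union[symmetric]) (auto simp: disjoint_family_on_def)
    also have "(\<Union>b\<in>B. {x \<in> space M. (\<beta> x, \<beta> (f x)) = (a, b)}) = {x \<in> space M. \<beta> x = a}"
      using inB by auto
    finally show ?thesis by (simp add: q_def)
  qed
  show "(\<Sum>a\<in>B. p (a, b)) = q b" if b: "b \<in> B" for b
  proof -
    have "(\<Sum>a\<in>B. p (a, b)) = measure M (\<Union>a\<in>B. {x \<in> space M. (\<beta> x, \<beta> (f x)) = (a, b)})"
      unfolding p_def using set2 b assms(2)
      by (intro finite_measure_finite_Union[symmetric]) (auto simp: disjoint_family_on_def)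
    also have "(\<Union>a\<in>B. {x \<in> space M. (\<beta> x, \<beta> (f x)) = (a, b)}) =
        f -` {x \<in> space M. \<beta> x = b} \<inter> space M"
      using inB measurable_space[OF f(1)] by auto
    also have "measure M \<dots> = measure (distr M M f) {x \<in> space M. \<beta> x = b}"
      by (rule measure_distr[OF f(1) set1[OF \<beta> b], symmetric])
    finally show ?thesis by (simp add: f(2) q_def)
  qed
  show "(\<Sum>a\<in>B. q a) = 1"
  proof -
    have "(\<Sum>a\<in>B. q a) = measure M (\<Union>a\<in>B. {x \<in> space M. \<beta> x = a})"
      unfolding q_def using set1[OF \<beta>] assms(2)
      by (intro finite_measure_finite_Union[symmetric]) (auto simp: disjoint_family_on_def)
    also have "(\<Union>a\<in>B. {x \<in> space M. \<beta> x = a}) = space M" using inB by auto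
    finally show ?thesis by (simp add: prob_space)
  qed
qed

section \<open>Finite models with the right two-point statistics\<close>

lemma finite_model_with_error_bound:
  fixes G :: "('g, 'c) monoid_scheme"
  assumes G: "free_group_rank G s r" and M: "prob_space M"
    and T: "T \<in> hom G (mp_aut_group M)" and B: "finite B"
    and \<beta>: "\<beta> \<in> measurable M (count_space B)" and n: "n \<ge> 1"
  obtains y \<sigma> where "y \<in> {1..n} \<rightarrow>\<^sub>E B" "\<sigma> \<in> hom G (sym_group n)"
    "d0_star G s r B (empirical_distr G B n \<sigma> y) (observable_distr G B M T \<beta>) \<le>
      real r * real (card B ^ 2) / real n"
proof -
  interpret prob_space M by fact
  have gG: "group G" "s ` {1..r} \<subseteq> carrier G" using G by (auto simp: free_group_rank_def)
  interpret G: group G by fact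
  have aut: "T g \<in> measurable M M" "distr M M (T g) = M" if "g \<in> carrier G" for g
    using hom_in_carrier[OF T that] by (auto simp: mp_aut_group_def mp_automorphisms_def)
  have T_one: "T \<one>\<^bsub>G\<^esub> x = x" if "x \<in> space M" for x
  proof -
    have "T \<one>\<^bsub>G\<^esub> = \<one>\<^bsub>mp_aut_group M\<^esub>"
      by (rule hom_one[OF T gG(1) mp_aut_group_is_group])
    then show ?thesis using that by (simp add: mp_aut_group_def BijGroup_def)
  qed
  have meas: "(\<lambda>x. \<beta> (T g x)) \<in> measurable M (count_space B)" if "g \<in> carrier G" for g
    using measurable_comp[OF aut(1)[OF that] \<beta>] by (simp add: comp_def)
  define p where "p = (\<lambda>i ab. measure M {x \<in> space M. (\<beta> x, \<beta> (T (s i) x)) = ab})"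
  define q where "q = (\<lambda>a. measure M {x \<in> space M. \<beta> x = a})"
  have si: "s i \<in> carrier G" if "i \<in> {1..r}" for i using gG(2) that by auto
  note laws = joint_law_marginals[OF M B \<beta>]
  have row: "(\<Sum>b\<in>B. p i (a, b)) = q a" if "i \<in> {1..r}" "a \<in> B" for i a
    unfolding p_def q_def by (rule laws(1)[OF aut[OF si[OF that(1)]] that(2)])
  have col: "(\<Sum>a\<in>B. p i (a, b)) = q b" if "i \<in> {1..r}" "b \<in> B" for i b
    unfolding p_def q_def by (rule laws(2)[OF aut[OF si[OF that(1)]] that(2)])
  have q1: "(\<Sum>a\<in>B. q a) = 1"
    unfolding q_def by (rule laws(3)[OF aut[OF G.one_closed]])
  obtain y \<tau> where y: "y \<in> {1..n} \<rightarrow>\<^sub>E B" and \<tau>: "\<And>i. i \<in> {1..r} \<Longrightarrow> \<tau> i permutes {1..n}"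
    and approx: "\<And>i ab. i \<in> {1..r} \<Longrightarrow> ab \<in> B \<times> B \<Longrightarrow>
      real (card {1..n}) * p i ab - 1 \<le> real (card {j \<in> {1..n}. (y j, y (\<tau> i j)) = ab})"
  proof (rule labeling_with_permutations[of B "{1..n}" q "{1..r}" p])
    show "q a \<ge> 0" for a by (simp add: q_def)
    show "p i ab \<ge> 0" for i ab by (simp add: p_def)
  qed (use B n q1 row col in auto)
  obtain \<sigma> where \<sigma>: "\<sigma> \<in> hom G (sym_group n)" and \<sigma>s: "\<And>i. i \<in> {1..r} \<Longrightarrow> \<sigma> (s i) = \<tau> i"
    using free_group_universal_property[OF G sym_group_is_group, of \<tau> n] \<tau>
    by (metis image_subsetI sym_group_carrier)
  have \<sigma>_one: "\<sigma> \<one>\<^bsub>G\<^esub> = id"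
    using hom_one[OF \<sigma> gG(1) sym_group_is_group] by (simp add: sym_group_def)
  let ?U = "uniform_count_measure {1..n}"
  have U: "space ?U = {1..n}" by (simp add: space_uniform_count_measure)
  have U_meas: "(\<lambda>j. y (\<sigma> g j)) \<in> measurable ?U (count_space B)" if "g \<in> carrier G" for g
  proof -
    have "\<sigma> g permutes {1..n}" using hom_in_carrier[OF \<sigma> that] by (simp add: sym_group_carrier)
    then have "y (\<sigma> g j) \<in> B" if "j \<in> {1..n}" for j
      using y that by (metis PiE_mem permutes_in_image)
    then show ?thesis
      unfolding measurable_def sets_uniform_count_measure U by (auto simp: sets_uniform_count_measure)
  qed
  have "marginal_dist B {\<one>\<^bsub>G\<^esub>, s i} (empirical_distr G B n \<sigma> y) (observable_distr G B M T \<beta>) \<le>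
      real (card B ^ 2) / real n" if i: "i \<in> {1..r}" for i
  proof -
    define u where "u = (\<lambda>ab. real (card {j \<in> {1..n}. (y j, y (\<tau> i j)) = ab}) / real n)"
    have emp: "measure ?U {j \<in> space ?U. (y (\<sigma> \<one>\<^bsub>G\<^esub> j), y (\<sigma> (s i) j)) = ab} = u ab" for ab
      unfolding U u_def \<sigma>_one \<sigma>s[OF i] by (subst measure_uniform_count_measure) auto
    have obs: "measure M {x \<in> space M. (\<beta> (T \<one>\<^bsub>G\<^esub> x), \<beta> (T (s i) x)) = ab} = p i ab" for ab
      unfolding p_def by (rule arg_cong[where f = "measure M"]) (auto simp: T_one)
    \<comment> \<open>The frequencies add up to 1: the points of \<open>{1..n}\<close> are grouped by their pair of labels.\<close>
    have "(\<Sum>ab\<in>B \<times> B. u ab) = 1"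
    proof -
      have "(\<Sum>ab\<in>B \<times> B. card {j \<in> {1..n}. (y j, y (\<tau> i j)) = ab}) = card {1..n}"
      proof -
        have "(\<lambda>j. (y j, y (\<tau> i j))) ` {1..n} \<subseteq> B \<times> B"
        proof (rule image_subsetI)
          fix j assume j: "j \<in> {1..n}"
          then have "\<tau> i j \<in> {1..n}" using permutes_in_image[OF \<tau>[OF i]] by blast
          then show "(y j, y (\<tau> i j)) \<in> B \<times> B" using y j by (intro SigmaI PiE_mem[OF y])
        qed
        then have "(\<Sum>ab\<in>B \<times> B. \<Sum>j\<in>{j \<in> {1..n}. (y j, y (\<tau> i j)) = ab}. 1::nat) =
            (\<Sum>j\<in>{1..n}. 1)"
          using B by (intro sum.group) auto
        then show ?thesis by simp
      qed
      then have "(\<Sum>ab\<in>B \<times> B. real (card {j \<in> {1..n}. (y j, y (\<tau> i j)) = ab})) = real n"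
        by (simp flip: of_nat_sum)
      then show ?thesis using n by (simp add: u_def flip: sum_divide_distrib)
    qed
    moreover have "(\<Sum>ab\<in>B \<times> B. p i ab) = 1"
      using row[OF i] q1 sum.cartesian_product[of "\<lambda>a b. p i (a, b)" B B] by simp
    moreover have "p i ab - 1 / real n \<le> u ab" if "ab \<in> B \<times> B" for ab
    proof -
      have "p i ab - 1 / real n = (real n * p i ab - 1) / real n"
        using n by (simp add: diff_divide_distrib)
      also have "\<dots> \<le> u ab"
        unfolding u_def using approx[OF i that] by (intro divide_right_mono) auto
      finally show ?thesis .
    qed
    ultimately have "(\<Sum>ab\<in>B \<times> B. \<bar>u ab - p i ab\<bar>) \<le> 2 * real (card (B \<times> B)) * (1 / real n)"
      by (intro l1_dist_le_of_one_sided) auto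
    moreover have "marginal_dist B {\<one>\<^bsub>G\<^esub>, s i} (empirical_distr G B n \<sigma> y)
        (observable_distr G B M T \<beta>) \<le> 1/2 * (\<Sum>ab\<in>B \<times> B. \<bar>u ab - p i ab\<bar>)"
      using marginal_dist_two_points_le[where S = \<sigma> and y = y and S' = T and y' = \<beta>,
          OF B G.one_closed si[OF i] U_meas meas]
      unfolding empirical_distr_def observable_distr_def emp obs by simp
    ultimately show ?thesis by (simp add: card_cartesian_product power2_eq_square)
  qed
  then have "d0_star G s r B (empirical_distr G B n \<sigma> y) (observable_distr G B M T \<beta>) \<le>
      (\<Sum>i = 1..r. real (card B ^ 2) / real n)"
    unfolding d0_star_def by (intro sum_mono)
  then show thesis using y \<sigma> by (intro that) auto
qed

theorem proposition1:
  fixes G :: "('g, 'c) monoid_scheme"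
    and s :: "nat \<Rightarrow> 'g"
    and r :: nat
    and M :: "'x measure"
    and T :: "'g \<Rightarrow> 'x \<Rightarrow> 'x"
    and B :: "'b set"
    and \<beta> :: "'x \<Rightarrow> 'b"
  assumes "r \<ge> 1"
    and "free_group_rank G s r"
    and "standard_prob_space M"
    and "T \<in> hom G (mp_aut_group M)"
    and "finite B"
    and "\<beta> \<in> measurable M (count_space B)"
  shows "\<exists>(y :: nat \<Rightarrow> nat \<Rightarrow> 'b) (\<sigma> :: nat \<Rightarrow> 'g \<Rightarrow> nat \<Rightarrow> nat).
    (\<forall>n\<ge>1. y n \<in> {1..n} \<rightarrow>\<^sub>E B \<and> \<sigma> n \<in> hom G (sym_group n)) \<and>
    (\<lambda>n. d0_star G s r B (empirical_distr G B n (\<sigma> n) (y n)) (observable_distr G B M T \<beta>))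
      \<longlonglongrightarrow> 0"
proof -
  have M: "prob_space M" using assms(3) by (simp add: standard_prob_space_def)
  define d where
    "d = (\<lambda>n y \<sigma>. d0_star G s r B (empirical_distr G B n \<sigma> y) (observable_distr G B M T \<beta>))"
  have "\<exists>y \<sigma>. y \<in> {1..n} \<rightarrow>\<^sub>E B \<and> \<sigma> \<in> hom G (sym_group n) \<and>
      d n y \<sigma> \<le> real r * real (card B ^ 2) / real n" if "n \<ge> 1" for n
    using finite_model_with_error_bound[OF assms(2) M assms(4-6) that] unfolding d_def by metis
  then obtain y \<sigma> where model: "\<And>n. n \<ge> 1 \<Longrightarrow> y n \<in> {1..n} \<rightarrow>\<^sub>E B \<and> \<sigma> n \<in> hom G (sym_group n) \<and>
      d n (y n) (\<sigma> n) \<le> real r * real (card B ^ 2) / real n"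
    by metis
  have nonneg: "d n y \<sigma> \<ge> 0" for n y \<sigma>
    by (auto simp: d_def d0_star_def marginal_dist_def intro!: sum_nonneg)
  have "(\<lambda>n. d n (y n) (\<sigma> n)) \<longlonglongrightarrow> 0"
  proof (rule tendsto_sandwich)
    show "\<forall>\<^sub>F n in sequentially. 0 \<le> d n (y n) (\<sigma> n)" by (simp add: nonneg)
    show "\<forall>\<^sub>F n in sequentially. d n (y n) (\<sigma> n) \<le> real r * real (card B ^ 2) / real n"
      using eventually_ge_at_top[of 1] by eventually_elim (use model in auto)
    show "(\<lambda>n. real r * real (card B ^ 2) / real n) \<longlonglongrightarrow> 0" by (rule lim_const_over_n)
  qed simp
  with model show ?thesis unfolding d_def by blast
qed

end
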